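(* Let $T_s>0$, $a_{\min}<0<a_{\max}$, $v_{\min}<v_{\max}$ and $R_{\text{designed}}>0$ be real numbers. Define $$n_+ := \left\lceil \frac{v_{\max}-v_{\min}}{T_s a_{\max}}\right\rceil,\qquad n_- := \left\lceil \frac{v_{\max}-v_{\min}}{T_s |a_{\min}|}\right\rceil,$$ $$\bar a_+ := \frac{v_{\max}-v_{\min}}{T_s n_+},\qquad \bar a_- := -\frac{v_{\max}-v_{\min}}{T_s n_-}.$$ Let $M$ be a positive integer (the number of periods), let $N=M(n_++n_-)$, and define the periodic acceleration sequence, for $k=1,\dots,N$, $$a(k)=\begin{cases}\bar a_+, & \text{if } (k-1)\bmod (n_++n_-)<n_+,\\ \bar a_-, & \text{otherwise.}\end{cases}$$ Suppose the system starts from initial velocity $v_{\min}$, so that the velocity at sampling instant $k$ is $v(k)=v_{\min}+T_s\sum_{\ell=1}^k a(\ell)$, and let $R(N)=\sum_{k=1}^N a(k)^2$. Then: 1) the velocity stays within the bounds: $v_{\min}\le v(k)\le v_{\max}$ for all $k=0,1,\dots,N$; 2) the quality constraint $R(N)\ge R_{\text{designed}}$ is satisfied if $$M\ge \frac{R_{\text{designed}}}{n_+\bar a_+^2+n_-\bar a_-^2}.$$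
   Context: A vehicle's longitudinal motion is sampled with sampling period $T_s$; the acceleration is constant and equal to $a(k)$ on the $k$-th sampling interval. $a_{\min},a_{\max}$ and $v_{\min},v_{\max}$ are time-invariant acceleration and velocity bounds. The quantity $R(N)=\sum_{k=1}^N a(k)^2$ (excitation energy) is required to be at least a prescribed level $R_{\text{designed}}$ (the quality constraint). *)

theory Defs
  imports Complex_Main
begin

text \<open>The ceilings are of positive reals wherever these are used, so that \<open>nat\<close> does not
  truncate and both step counts are at least 1.\<close>

definition n_plus :: "real \<Rightarrow> real \<Rightarrow> real \<Rightarrow> real \<Rightarrow> nat" where
  "n_plus Ts amax vmin vmax = nat \<lceil>(vmax - vmin) / (Ts * amax)\<rceil>"

definition n_minus :: "real \<Rightarrow> real \<Rightarrow> real \<Rightarrow> real \<Rightarrow> nat" where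
  "n_minus Ts amin vmin vmax = nat \<lceil>(vmax - vmin) / (Ts * \<bar>amin\<bar>)\<rceil>"

definition abar_plus :: "real \<Rightarrow> real \<Rightarrow> real \<Rightarrow> real \<Rightarrow> real" where
  "abar_plus Ts amax vmin vmax =
     (vmax - vmin) / (Ts * real (n_plus Ts amax vmin vmax))"

definition abar_minus :: "real \<Rightarrow> real \<Rightarrow> real \<Rightarrow> real \<Rightarrow> real" where
  "abar_minus Ts amin vmin vmax =
     - ((vmax - vmin) / (Ts * real (n_minus Ts amin vmin vmax)))"

text \<open>Only the values at \<open>k \<ge> 1\<close> are meaningful: the first sampling interval has index 1.\<close>

definition periodic_acc :: "real \<Rightarrow> real \<Rightarrow> real \<Rightarrow> real \<Rightarrow> real \<Rightarrow> nat \<Rightarrow> real" where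
  "periodic_acc Ts amin amax vmin vmax k =
     (if (k - 1) mod (n_plus Ts amax vmin vmax + n_minus Ts amin vmin vmax)
           < n_plus Ts amax vmin vmax
      then abar_plus Ts amax vmin vmax
      else abar_minus Ts amin vmin vmax)"

definition velocity :: "real \<Rightarrow> real \<Rightarrow> (nat \<Rightarrow> real) \<Rightarrow> nat \<Rightarrow> real" where
  "velocity Ts v0 a k = v0 + Ts * (\<Sum>l=1..k. a l)"

definition excitation_energy :: "(nat \<Rightarrow> real) \<Rightarrow> nat \<Rightarrow> real" where
  "excitation_energy a N = (\<Sum>k=1..N. (a k)\<^sup>2)"

end

theory Submission
  imports Defs
begin

text \<open>With \<open>D = vmax - vmin\<close>, one period raises the velocity by \<open>n\<^sub>+\<close> steps of \<open>D / n\<^sub>+\<close>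
  and then lowers it by \<open>n\<^sub>-\<close> steps of \<open>D / n\<^sub>-\<close>. The net change over a period is zero, so the
  velocity depends only on the phase within the period and traces a triangle between \<open>vmin\<close>
  and \<open>vmax\<close>; each period contributes the same energy.\<close>

text \<open>The truncated subtraction \<open>n mod (p + q) - p\<close> counts the steps of the current period that
  lie in its second phase, and is 0 during the first phase.\<close>

lemma sum_two_phase:
  fixes x y :: real and p q n :: nat
  assumes "0 < p" "0 < q"
  shows "(\<Sum>l=1..n. if (l - 1) mod (p + q) < p then x else y) =
    real (n div (p + q)) * (real p * x + real q * y)
    + real (min (n mod (p + q)) p) * x + real (n mod (p + q) - p) * y"
proof (induction n)
  case 0
  then show ?case by simp
next
  case (Suc n)
  define r where "r = n mod (p + q)"
  \<comment> \<open>Indices start at 1, so the summand at \<open>Suc n\<close> is selected by the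
    phase \<open>r\<close> of \<open>n\<close>.\<close>
  have step: "(\<Sum>l=1..Suc n. if (l - 1) mod (p + q) < p then x else y) =
      real (n div (p + q)) * (real p * x + real q * y)
      + real (min r p) * x + real (r - p) * y + (if r < p then x else y)"
    using Suc by (simp add: r_def)
  show ?case
  proof (cases "Suc r = p + q")
    \<comment> \<open>The added step is the last of its period: the partial counts \<open>p\<close>
      and \<open>q - 1\<close> become a full \<open>p\<close> and \<open>q\<close>, which the
      quotient term absorbs.\<close>
    case True
    then have "Suc n mod (p + q) = 0" "Suc n div (p + q) = Suc (n div (p + q))"
      by (simp_all add: r_def mod_Suc div_Suc)
    moreover have "\<not> r < p" "min r p = p" using True assms by auto
    moreover obtain q' where "q = Suc q'" using assms(2) gr0_implies_Suc by blast
    moreover from this have "r - p = q'" using True by simp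
    ultimately show ?thesis unfolding step by (simp add: algebra_simps)
  next
    case False
    then have "Suc n mod (p + q) = Suc r" "Suc n div (p + q) = n div (p + q)"
      by (simp_all add: r_def mod_Suc div_Suc)
    moreover have "real (min (Suc r) p) = real (min r p) + (if r < p then 1 else 0)"
      and "real (Suc r - p) = real (r - p) + (if r < p then 0 else 1)"
      by (auto simp: of_nat_diff)
    ultimately show ?thesis unfolding step by (simp add: algebra_simps)
  qed
qed

text \<open>While rising, \<open>w\<close> is the fraction \<open>r / p\<close> of \<open>D\<close>;
  while falling, it is \<open>D\<close> less the fraction \<open>(r - p) / q\<close> of
  \<open>D\<close>. Both fractions lie between 0 and 1.\<close>

lemma triangle_wave_bounds:
  fixes D :: real and p q r :: nat
  assumes "0 < p" "0 < q" "0 \<le> D" "r \<le> p + q"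
  defines "w \<equiv> real (min r p) * (D / real p) - real (r - p) * (D / real q)"
  shows "0 \<le> w" "w \<le> D"
proof -
  have frac: "0 \<le> real m * (D / real n) \<and> real m * (D / real n) \<le> D"
    if "m \<le> n" "0 < n" for m n
    using that assms(3) by (simp add: field_simps mult_left_mono)
  have "0 \<le> w \<and> w \<le> D"
  proof (cases "r \<le> p")
    case True
    then show ?thesis using frac[of r p] assms(1) by (simp add: w_def)
  next
    case False
    then have "w = D - real (r - p) * (D / real q)" using assms(1) by (simp add: w_def)
    then show ?thesis using frac[of "r - p" q] assms(2,4) by auto
  qed
  then show "0 \<le> w" "w \<le> D" by auto
qed

theorem theorem1:
  fixes Ts amin amax vmin vmax Rdesigned :: real
    and M N np nm :: nat
    and ap am :: real
    and a :: "nat \<Rightarrow> real"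
  assumes "Ts > 0"
    and "amin < 0" and "0 < amax"
    and "vmin < vmax"
    and "Rdesigned > 0"
    and "M \<ge> 1"
    and "np = n_plus Ts amax vmin vmax"
    and "nm = n_minus Ts amin vmin vmax"
    and "ap = abar_plus Ts amax vmin vmax"
    and "am = abar_minus Ts amin vmin vmax"
    and "N = M * (np + nm)"
    and "a = periodic_acc Ts amin amax vmin vmax"
  shows "(\<forall>k\<in>{0..N}. vmin \<le> velocity Ts vmin a k \<and> velocity Ts vmin a k \<le> vmax)
    \<and> (real M \<ge> Rdesigned / (real np * ap\<^sup>2 + real nm * am\<^sup>2)
         \<longrightarrow> excitation_energy a N \<ge> Rdesigned)"
proof -
  define D where "D = vmax - vmin"
  have D: "0 < D" using assms(4) by (simp add: D_def)
  have pos: "0 < np" "0 < nm"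
    using assms(1-4) by (simp_all add: assms(7,8) n_plus_def n_minus_def divide_pos_neg mult_pos_neg)
  have ap: "ap = D / (Ts * real np)" and am: "am = - (D / (Ts * real nm))"
    by (simp_all add: assms(7-10) abar_plus_def abar_minus_def D_def)
  have a: "a = (\<lambda>k. if (k - 1) mod (np + nm) < np then ap else am)"
    by (simp add: fun_eq_iff assms(7-10,12) periodic_acc_def)
  have Ts_ap: "Ts * ap = D / real np" and Ts_am: "Ts * am = - (D / real nm)"
    using assms(1) by (simp_all add: ap am)
  \<comment> \<open>This removes the completed-periods term of \<open>sum_two_phase\<close> from the
    velocity.\<close>
  have no_drift: "real np * ap + real nm * am = 0"
    using pos assms(1) by (simp add: ap am field_simps)
  have vel: "velocity Ts vmin a k = vmin + (real (min (k mod (np + nm)) np) * (D / real np)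
      - real (k mod (np + nm) - np) * (D / real nm))" for k
  proof -
    have "velocity Ts vmin a k = vmin + (real (min (k mod (np + nm)) np) * (Ts * ap)
        + real (k mod (np + nm) - np) * (Ts * am))"
      unfolding velocity_def a sum_two_phase[OF pos] no_drift by (simp add: algebra_simps)
    then show ?thesis unfolding Ts_ap Ts_am by simp
  qed
  have "vmin \<le> velocity Ts vmin a k \<and> velocity Ts vmin a k \<le> vmax" for k
    using triangle_wave_bounds[OF pos, of D "k mod (np + nm)"] D pos
    unfolding vel by (simp add: D_def less_imp_le)
  moreover have "excitation_energy a N \<ge> Rdesigned"
    if M: "real M \<ge> Rdesigned / (real np * ap\<^sup>2 + real nm * am\<^sup>2)"
  proof -
    \<comment> \<open>Squaring preserves the two-phase pattern, so \<open>sum_two_phase\<close>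
      applies again.\<close>
    have sq: "(\<lambda>k. (a k)\<^sup>2) = (\<lambda>k. if (k - 1) mod (np + nm) < np then ap\<^sup>2 else am\<^sup>2)"
      by (auto simp: a)
    \<comment> \<open>\<open>N\<close> is a whole number of periods, so both partial-period terms
      vanish.\<close>
    have "excitation_energy a N = real M * (real np * ap\<^sup>2 + real nm * am\<^sup>2)"
      unfolding excitation_energy_def sq sum_two_phase[OF pos] assms(11) using pos by simp
    moreover have "0 < real np * ap\<^sup>2 + real nm * am\<^sup>2"
      using pos D assms(1) by (intro add_pos_pos mult_pos_pos) (simp_all add: ap am)
    ultimately show ?thesis using M by (simp add: pos_divide_le_eq)
  qed
  ultimately show ?thesis by blast
qed

end
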